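(* Let $f_{\theta,\alpha}:\mathbb{R}^n\to\mathbb{R}^n$ be a Learned Proximal Network (LPN) with differentiable activation function, strong convexity modulus $\alpha\in(0,1)$, potential $\Psi_{\theta,\alpha}$ and implicit regularizer $\varphi_{\theta,\alpha}$. Let $0<\gamma\le1$ and $x\in\mathbb{R}^n$, and define $$G(w)\coloneqq\frac{\gamma}{2}\|w\|^2+(1-\gamma)\Psi_{\theta,\alpha}(w)-\langle x,w\rangle,\qquad w\in\mathbb{R}^n.$$ Then $G$ is $(\gamma+(1-\gamma)\alpha)$-strongly convex, hence has a unique minimizer $w^*$, and $$\operatorname{prox}_{\gamma\varphi_{\theta,\alpha}}(x)=f_{\theta,\alpha}(w^* ).$$
   Context: Norms and inner products are Euclidean. For $h:\mathbb{R}^n\to\mathbb{R}$ and $\gamma>0$, $\operatorname{prox}_{\gamma h}(x)\coloneqq\operatorname{argmin}_{z\in\mathbb{R}^n}\{h(z)+\frac{1}{2\gamma}\|z-x\|^2\}$. ICNN: An input convex neural network is a function $\psi_\theta:\mathbb{R}^n\to\mathbb{R}$, $\psi_\theta(x)\coloneqq z_K$, where $z_{i+1}\coloneqq\sigma(W_iz_i+H_ix+b_i)$ for $i=0,\dots,K-1$, with $W_0,z_0\equiv 0$; here $H_i,W_i$ are linear maps (of compatible dimensions, $z_K$ scalar), each $W_i$ has non-negative entries, $b_i$ are bias vectors, and the activation $\sigma:\mathbb{R}\to\mathbb{R}$ is convex and non-decreasing, applied element-wise. LPN: $f_{\theta,\alpha}:\mathbb{R}^n\to\mathbb{R}^n$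 is an LPN with strong convexity modulus $\alpha$ if $0<\alpha<1$ and $f_{\theta,\alpha}(y)\in\partial\psi_\theta(y)+\alpha y$ for all $y$, where $\psi_\theta$ is an ICNN with Lipschitz activation $\sigma$ and $\partial$ is the convex subdifferential. Its potential is $\Psi_{\theta,\alpha}\coloneqq\psi_\theta+\frac{\alpha}{2}\|\cdot\|^2$ and its implicit regularizer is $\varphi_{\theta,\alpha}\coloneqq\Psi_{\theta,\alpha}^*-\frac12\|\cdot\|^2$, where $\Psi^*(y)\coloneqq\sup_x\{\langle x,y\rangle-\Psi(x)\}$ is the convex conjugate. When $\sigma$ is differentiable, $f_{\theta,\alpha}=\nabla\Psi_{\theta,\alpha}$. *)

theory Defs
  imports "HOL-Analysis.Analysis"
begin

text \<open>
  Layer \<open>i\<close> has \<open>width i\<close> neurons, indexed by \<open>0, ..., width i - 1\<close>.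
  \<open>wmat i\<close> is the entry function of the matrix of \<open>W_i\<close>, which has \<open>width (i + 1)\<close> rows and
  \<open>width i\<close> columns; \<open>hrow i j\<close> is row \<open>j\<close> of the matrix of \<open>H_i\<close>; \<open>bias i\<close> is \<open>b_i\<close>.
  Values at indices outside these ranges are irrelevant.
\<close>

record ('n::finite) icnn_params =
  depth :: nat
  width :: "nat \<Rightarrow> nat"
  wmat :: "nat \<Rightarrow> nat \<Rightarrow> nat \<Rightarrow> real"
  hrow :: "nat \<Rightarrow> nat \<Rightarrow> real^'n"
  bias :: "nat \<Rightarrow> nat \<Rightarrow> real"

definition valid_icnn_params :: "('n::finite) icnn_params \<Rightarrow> bool" where
  "valid_icnn_params \<theta> \<longleftrightarrow>
     width \<theta> (depth \<theta>) = 1 \<and>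
     (\<forall>i<depth \<theta>. \<forall>j<width \<theta> (Suc i). \<forall>k<width \<theta> i. 0 \<le> wmat \<theta> i j k) \<and>
     (\<forall>j<width \<theta> 1. \<forall>k<width \<theta> 0. wmat \<theta> 0 j k = 0)"

definition icnn_activation :: "(real \<Rightarrow> real) \<Rightarrow> bool" where
  "icnn_activation \<sigma> \<longleftrightarrow> convex_on UNIV \<sigma> \<and> mono \<sigma>"

primrec icnn_layer ::
    "(real \<Rightarrow> real) \<Rightarrow> ('n::finite) icnn_params \<Rightarrow> real^'n \<Rightarrow> nat \<Rightarrow> nat \<Rightarrow> real" where
  "icnn_layer \<sigma> \<theta> x 0 = (\<lambda>j. 0)"
| "icnn_layer \<sigma> \<theta> x (Suc i) =
     (\<lambda>j. \<sigma> ((\<Sum>k<width \<theta> i. wmat \<theta> i j k * icnn_layer \<sigma> \<theta> x i k) + hrow \<theta> i j \<bullet> x + bias \<theta> i j))"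

definition icnn :: "(real \<Rightarrow> real) \<Rightarrow> ('n::finite) icnn_params \<Rightarrow> real^'n \<Rightarrow> real" where
  "icnn \<sigma> \<theta> x = icnn_layer \<sigma> \<theta> x (depth \<theta>) 0"

definition subdifferential :: "('a::real_inner \<Rightarrow> real) \<Rightarrow> 'a \<Rightarrow> 'a set" where
  "subdifferential g y = {v. \<forall>z. g y + v \<bullet> (z - y) \<le> g z}"

definition is_LPN ::
    "(real \<Rightarrow> real) \<Rightarrow> ('n::finite) icnn_params \<Rightarrow> real \<Rightarrow> (real^'n \<Rightarrow> real^'n) \<Rightarrow> bool" where
  "is_LPN \<sigma> \<theta> \<alpha> f \<longleftrightarrow>
     0 < \<alpha> \<and> \<alpha> < 1 \<and>
     valid_icnn_params \<theta> \<and> icnn_activation \<sigma> \<and> (\<exists>L. L-lipschitz_on UNIV \<sigma>) \<and>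
     (\<forall>y. f y \<in> (\<lambda>v. v + \<alpha> *\<^sub>R y) ` subdifferential (icnn \<sigma> \<theta>) y)"

definition lpn_potential ::
    "(real \<Rightarrow> real) \<Rightarrow> ('n::finite) icnn_params \<Rightarrow> real \<Rightarrow> real^'n \<Rightarrow> real" where
  "lpn_potential \<sigma> \<theta> \<alpha> x = icnn \<sigma> \<theta> x + \<alpha> / 2 * (norm x)\<^sup>2"

text \<open>
  The conjugate takes values in the extended reals, so that the supremum is always the
  true one.  (For a supremum in \<open>real\<close>, unbounded sets give an unspecified value.)
\<close>

definition convex_conjugate :: "('a::real_inner \<Rightarrow> real) \<Rightarrow> 'a \<Rightarrow> ereal" where
  "convex_conjugate g y = (SUP x. ereal (x \<bullet> y - g x))"

definition lpn_regularizer ::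
    "(real \<Rightarrow> real) \<Rightarrow> ('n::finite) icnn_params \<Rightarrow> real \<Rightarrow> real^'n \<Rightarrow> ereal" where
  "lpn_regularizer \<sigma> \<theta> \<alpha> y =
     convex_conjugate (lpn_potential \<sigma> \<theta> \<alpha>) y - ereal (1 / 2 * (norm y)\<^sup>2)"

definition minimizers :: "('a \<Rightarrow> 'b::order) \<Rightarrow> 'a set" where
  "minimizers g = {z. is_arg_min g (\<lambda>_. True) z}"

text \<open>\<open>prox \<gamma> h\<close> is the set-valued proximal operator of \<open>\<gamma> h\<close>.\<close>

definition prox :: "real \<Rightarrow> ('a::real_inner \<Rightarrow> ereal) \<Rightarrow> 'a \<Rightarrow> 'a set" where
  "prox \<gamma> h x = minimizers (\<lambda>z. h z + ereal (1 / (2 * \<gamma>) * (norm (z - x))\<^sup>2))"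

definition strongly_convex :: "real \<Rightarrow> ('a::real_inner \<Rightarrow> real) \<Rightarrow> bool" where
  "strongly_convex \<mu> g \<longleftrightarrow> 0 < \<mu> \<and>
     (\<forall>x y. \<forall>t\<in>{0..1}. g ((1 - t) *\<^sub>R x + t *\<^sub>R y)
        \<le> (1 - t) * g x + t * g y - \<mu> / 2 * t * (1 - t) * (norm (x - y))\<^sup>2)"

end

theory Submission
  imports Defs
begin

text \<open>
  At the minimizer \<open>w\<close> of \<open>G\<close> the gradient vanishes: \<open>\<gamma> w + (1 - \<gamma>) f w = x\<close>.  Bounding \<open>\<Psi>\<^sup>*\<close> from
  below by the affine function \<open>z \<mapsto> z \<bullet> w - \<Psi> w\<close> (Fenchel--Young) turns the objective of the proximal
  problem into a quadratic with leading coefficient \<open>(1 / \<gamma> - 1) / 2 \<ge> 0\<close>, and the equation above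
  says that \<open>f w\<close> is critical for it.  The bound is attained at \<open>f w\<close>, so \<open>f w\<close> is a minimizer.  Any
  other minimizer \<open>z\<close> also attains the bound, that is \<open>z \<in> \<partial>\<Psi> w\<close>, and \<open>\<partial>\<Psi> w = {f w}\<close> because
  \<open>\<Psi>\<close> is differentiable.  Uniqueness thus covers \<open>\<gamma> = 1\<close>, where the quadratic is constant.
\<close>

section \<open>Strong convexity and existence of unique minimizers\<close>

lemma norm_sq_convex_combination:
  fixes x y :: "'a::real_inner"
  shows "(norm ((1 - t) *\<^sub>R x + t *\<^sub>R y))\<^sup>2 =
    (1 - t) * (norm x)\<^sup>2 + t * (norm y)\<^sup>2 - t * (1 - t) * (norm (x - y))\<^sup>2"
  unfolding power2_norm_eq_inner
  by (simp add: inner_add_left inner_add_right inner_diff_left inner_diff_right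
      inner_commute[of y x]) (simp add: algebra_simps power2_eq_square)

text \<open>By the identity above, the quadratic term satisfies the strong convexity inequality with
  equality, so only the convexity of \<open>h\<close> remains to be used.\<close>

lemma strongly_convex_add_norm_sq:
  fixes h :: "'a::real_inner \<Rightarrow> real"
  assumes "convex_on UNIV h" and "0 < \<mu>"
  shows "strongly_convex \<mu> (\<lambda>w. h w + \<mu> / 2 * (norm w)\<^sup>2)"
  unfolding strongly_convex_def
proof (intro conjI allI ballI)
  fix x y :: 'a and t :: real
  assume "t \<in> {0..1}"
  then have "h ((1 - t) *\<^sub>R x + t *\<^sub>R y) \<le> (1 - t) * h x + t * h y"
    using convex_onD[OF assms(1)] by auto
  then show "h ((1 - t) *\<^sub>R x + t *\<^sub>R y) + \<mu> / 2 * (norm ((1 - t) *\<^sub>R x + t *\<^sub>R y))\<^sup>2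
      \<le> (1 - t) * (h x + \<mu> / 2 * (norm x)\<^sup>2) + t * (h y + \<mu> / 2 * (norm y)\<^sup>2)
        - \<mu> / 2 * t * (1 - t) * (norm (x - y))\<^sup>2"
    unfolding norm_sq_convex_combination
    by (simp add: distrib_left distrib_right left_diff_distrib right_diff_distrib
        add_divide_distrib diff_divide_distrib mult_ac)
qed (use assms in auto)

lemma minimizers_iff:
  fixes g :: "'a \<Rightarrow> 'b::linorder"
  shows "z \<in> minimizers g \<longleftrightarrow> (\<forall>y. g z \<le> g y)"
  by (auto simp: minimizers_def is_arg_min_def not_less)

lemma strongly_convex_midpoint:
  assumes "strongly_convex \<mu> g"
  shows "g ((1 / 2) *\<^sub>R (x + y)) \<le> (g x + g y) / 2 - \<mu> / 8 * (norm (x - y))\<^sup>2"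
proof -
  have "(1 / 2 :: real) \<in> {0..1}"
    by simp
  then have "g ((1 - 1 / 2) *\<^sub>R x + (1 / 2) *\<^sub>R y)
      \<le> (1 - 1 / 2) * g x + 1 / 2 * g y - \<mu> / 2 * (1 / 2) * (1 - 1 / 2) * (norm (x - y))\<^sup>2"
    using assms unfolding strongly_convex_def by blast
  then show ?thesis
    by (simp add: scaleR_add_right field_simps)
qed

text \<open>A single subgradient already gives quadratic growth away from \<open>y\<close>, so the
  minimum over a large compact ball around \<open>y\<close> is global.\<close>

lemma strongly_convex_unique_minimizer:
  fixes g :: "'a::euclidean_space \<Rightarrow> real"
  assumes sc: "strongly_convex \<mu> g" and cont: "continuous_on UNIV g"
    and v: "v \<in> subdifferential g y"
  shows "\<exists>w. minimizers g = {w}"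
proof -
  have \<mu>: "0 < \<mu>"
    using sc by (simp add: strongly_convex_def)
  \<comment> \<open>Beyond this radius the term \<open>\<mu> / 4 * (norm (w - y))\<^sup>2\<close>
    obtained from the midpoint inequality dominates \<open>norm v * norm (w - y)\<close>, the
    Cauchy-Schwarz bound on the linear term.\<close>
  define R where "R = 4 * norm v / \<mu>"
  have coercive: "g y \<le> g w" if "R < norm (w - y)" for w
  proof -
    have "g y + v \<bullet> ((1 / 2) *\<^sub>R (y + w) - y) \<le> (g y + g w) / 2 - \<mu> / 8 * (norm (y - w))\<^sup>2"
      using v strongly_convex_midpoint[OF sc, of y w]
      unfolding subdifferential_def by (blast intro: order_trans)
    moreover have "(1 / 2) *\<^sub>R (y + w) - y = (1 / 2) *\<^sub>R (w - y)"
      by (simp add: algebra_simps flip: scaleR_add_left)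
    ultimately have "g y + v \<bullet> (w - y) / 2 \<le> (g y + g w) / 2 - \<mu> / 8 * (norm (w - y))\<^sup>2"
      by (simp add: norm_minus_commute)
    then have "g y + v \<bullet> (w - y) + \<mu> / 4 * (norm (w - y))\<^sup>2 \<le> g w"
      by (simp add: field_simps)
    moreover have "- (norm v * norm (w - y)) \<le> v \<bullet> (w - y)"
      using Cauchy_Schwarz_ineq2[of v "w - y"] by linarith
    moreover have "norm v * norm (w - y) \<le> \<mu> / 4 * norm (w - y) * norm (w - y)"
      using that \<mu> by (intro mult_right_mono) (auto simp: R_def field_simps)
    ultimately show ?thesis
      unfolding power2_eq_square by linarith
  qed
  have "0 \<le> R"
    using \<mu> by (simp add: R_def)
  then have "\<exists>w\<in>cball y R. \<forall>u\<in>cball y R. g w \<le> g u"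
    by (intro continuous_attains_inf compact_cball continuous_on_subset[OF cont]) auto
  then obtain w where w: "\<And>u. u \<in> cball y R \<Longrightarrow> g w \<le> g u"
    by blast
  have min: "g w \<le> g u" for u
  proof (cases "u \<in> cball y R")
    case False
    then have "g y \<le> g u"
      by (intro coercive) (simp add: dist_norm norm_minus_commute)
    then show ?thesis
      using w[of y] \<open>0 \<le> R\<close> by (simp add: order_trans)
  qed (rule w)
  have "u = w" if "\<forall>z. g u \<le> g z" for u
  proof -
    \<comment> \<open>Both minimizers have the same value, so the midpoint inequality leaves no room
      for a positive distance between them.\<close>
    have "g u \<le> (g w + g u) / 2 - \<mu> / 8 * (norm (w - u))\<^sup>2"
      by (rule order_trans[OF that[rule_format] strongly_convex_midpoint[OF sc]])
    moreover have "g u = g w"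
      using that min by (simp add: order_antisym)
    ultimately show ?thesis
      using \<mu> by (simp add: mult_le_0_iff)
  qed
  then have "minimizers g = {w}"
    using min by (auto simp: minimizers_iff)
  then show ?thesis ..
qed

section \<open>Subgradients, their uniqueness and their calculus\<close>

lemma has_derivative_subgradient:
  fixes g :: "'a::real_inner \<Rightarrow> real"
  assumes "g differentiable (at y)" and "v \<in> subdifferential g y"
  shows "(g has_derivative (\<bullet>) v) (at y)"
proof -
  obtain D where D: "(g has_derivative D) (at y)"
    using assms(1) by (auto simp: differentiable_def)
  \<comment> \<open>Subtracting the linear function turns \<open>y\<close> into a global minimizer,
    where the derivative has to vanish.\<close>
  have "((\<lambda>z. g z - v \<bullet> z) has_derivative (\<lambda>h. D h - v \<bullet> h)) (at y)"
    by (intro derivative_intros D)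
  moreover have "g y - v \<bullet> y \<le> g z - v \<bullet> z" for z
  proof -
    have "g y + v \<bullet> (z - y) \<le> g z"
      using assms(2) by (simp add: subdifferential_def)
    then show ?thesis
      by (simp add: inner_diff_right)
  qed
  ultimately have "(\<lambda>h. D h - v \<bullet> h) = (\<lambda>h. 0)"
    by (intro differential_zero_maxmin[where x = y and S = UNIV]) auto
  then have "D = (\<bullet>) v"
    by (auto simp: fun_eq_iff)
  with D show ?thesis by simp
qed

text \<open>Serves twice: to identify the zero subgradient of \<open>G\<close> at its minimizer, and
  to exclude a second proximal point.\<close>

lemma subgradient_unique:
  fixes g :: "'a::real_inner \<Rightarrow> real"
  assumes "g differentiable (at y)" "u \<in> subdifferential g y" "v \<in> subdifferential g y"
  shows "u = v"
proof -
  have "(\<bullet>) u = (\<bullet>) v"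
    by (rule has_derivative_unique) (use assms has_derivative_subgradient in blast)+
  then show ?thesis
    by (metis inner_commute vector_eq_ldot)
qed

lemma subdifferential_add:
  assumes "u \<in> subdifferential g y" "v \<in> subdifferential h y"
  shows "u + v \<in> subdifferential (\<lambda>z. g z + h z) y"
  using assms by (simp add: subdifferential_def inner_add_left) (smt (verit))

lemma subdifferential_scale:
  assumes "0 \<le> c" "u \<in> subdifferential g y"
  shows "c *\<^sub>R u \<in> subdifferential (\<lambda>z. c * g z) y"
  using assms by (auto simp: subdifferential_def simp flip: distrib_left intro: mult_left_mono)

lemma subdifferential_inner: "u \<in> subdifferential ((\<bullet>) u) y"
  by (simp add: subdifferential_def inner_diff_right)

lemma subdifferential_half_norm_sq: "y \<in> subdifferential (\<lambda>z. 1 / 2 * (norm z)\<^sup>2) y"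
proof -
  have "1 / 2 * (norm y)\<^sup>2 + y \<bullet> (z - y) \<le> 1 / 2 * (norm z)\<^sup>2" for z
    \<comment> \<open>The two sides differ by half of
      \<open>(z - y) \<bullet> (z - y)\<close>.\<close>
    using inner_ge_zero[of "z - y"]
    unfolding power2_norm_eq_inner inner_diff_left inner_diff_right inner_commute[of z y]
    by linarith
  then show ?thesis
    by (simp add: subdifferential_def)
qed

section \<open>Convexity and differentiability of the network and its potential\<close>

lemma convex_on_sum_functions:
  assumes "convex S" "\<And>i. i \<in> A \<Longrightarrow> convex_on S (f i)"
  shows "convex_on S (\<lambda>x. \<Sum>i\<in>A. f i x)"
  using assms(2)
  by (induction A rule: infinite_finite_induct) (auto simp: convex_on_const assms(1))

text \<open>Non-negative weights keep the preactivation convex, and a convex non-decreasing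
  \<open>\<sigma>\<close> preserves convexity. The bounds on \<open>i\<close> and \<open>j\<close>
  are there because the signs of the weights are known only in that range.\<close>

lemma icnn_layer_convex:
  assumes "valid_icnn_params \<theta>" "icnn_activation \<sigma>" "i \<le> depth \<theta>" "j < width \<theta> i"
  shows "convex_on UNIV (\<lambda>x. icnn_layer \<sigma> \<theta> x i j)"
  using assms(3,4)
proof (induction i arbitrary: j)
  case (Suc i)
  let ?a = "\<lambda>x. (\<Sum>k<width \<theta> i. wmat \<theta> i j k * icnn_layer \<sigma> \<theta> x i k) + hrow \<theta> i j \<bullet> x + bias \<theta> i j"
  have "convex_on UNIV (\<lambda>x. \<Sum>k<width \<theta> i. wmat \<theta> i j k * icnn_layer \<sigma> \<theta> x i k)"
    using Suc assms(1)
    by (intro convex_on_sum_functions convex_on_cmul) (auto simp: valid_icnn_params_def)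
  moreover have "convex_on UNIV (\<lambda>x. hrow \<theta> i j \<bullet> x + bias \<theta> i j)"
    by (intro convex_onI) (auto simp: inner_add_right algebra_simps)
  ultimately have "convex_on UNIV ?a"
    by (subst add.assoc) (rule convex_on_add)
  moreover have \<sigma>: "convex_on UNIV \<sigma>" "mono \<sigma>"
    using assms(2) by (auto simp: icnn_activation_def)
  ultimately have "convex_on UNIV (\<lambda>x. \<sigma> (?a x))"
  proof (intro convex_onI)
    fix t :: real and x y
    assume a: "convex_on UNIV ?a" and t: "0 < t" "t < 1"
    have "\<sigma> (?a ((1 - t) *\<^sub>R x + t *\<^sub>R y)) \<le> \<sigma> ((1 - t) * ?a x + t * ?a y)"
      using t by (intro monoD[OF \<sigma>(2)] convex_onD[OF a]) auto
    also have "\<dots> \<le> (1 - t) * \<sigma> (?a x) + t * \<sigma> (?a y)"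
      using convex_onD[OF \<sigma>(1), of t "?a x" "?a y"] t by simp
    finally show "\<sigma> (?a ((1 - t) *\<^sub>R x + t *\<^sub>R y)) \<le> (1 - t) * \<sigma> (?a x) + t * \<sigma> (?a y)" .
  qed auto
  then show ?case by simp
qed (simp add: convex_on_const)

lemma icnn_convex:
  assumes "valid_icnn_params \<theta>" "icnn_activation \<sigma>"
  shows "convex_on UNIV (icnn \<sigma> \<theta>)"
  using icnn_layer_convex[OF assms, of "depth \<theta>" 0] assms(1)
  by (simp add: icnn_def[abs_def] valid_icnn_params_def)

lemma icnn_layer_differentiable:
  assumes "\<And>t. \<sigma> differentiable (at t)"
  shows "(\<lambda>x. icnn_layer \<sigma> \<theta> x i j) differentiable (at x)"
proof (induction i arbitrary: j)
  case (Suc i)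
  have "(\<lambda>x. (\<Sum>k<width \<theta> i. wmat \<theta> i j k * icnn_layer \<sigma> \<theta> x i k) + hrow \<theta> i j \<bullet> x + bias \<theta> i j)
      differentiable (at x)"
    by (intro differentiable_add differentiable_sum differentiable_mult differentiable_inner
        differentiable_const differentiable_ident finite_lessThan ballI Suc.IH)
  from differentiable_chain_at[OF this assms] show ?case
    by (simp add: o_def)
qed simp

lemma lpn_potential_differentiable:
  assumes "\<And>t. \<sigma> differentiable (at t)"
  shows "lpn_potential \<sigma> \<theta> \<alpha> differentiable (at x)"
  unfolding lpn_potential_def[abs_def] icnn_def power2_norm_eq_inner
  by (intro differentiable_add differentiable_mult differentiable_inner differentiable_const
      differentiable_ident icnn_layer_differentiable assms)

lemma lpn_subgradient_potential:
  assumes "is_LPN \<sigma> \<theta> \<alpha> f"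
  shows "f y \<in> subdifferential (lpn_potential \<sigma> \<theta> \<alpha>) y"
proof -
  obtain v where v: "v \<in> subdifferential (icnn \<sigma> \<theta>) y" "f y = v + \<alpha> *\<^sub>R y" and "0 \<le> \<alpha>"
    using assms by (force simp: is_LPN_def)
  from subdifferential_add[OF v(1) subdifferential_scale[OF \<open>0 \<le> \<alpha>\<close> subdifferential_half_norm_sq]]
  show ?thesis
    by (simp add: v(2) lpn_potential_def[abs_def])
qed

section \<open>Conjugates and the proximal operator\<close>

lemma fenchel_young: "ereal (z \<bullet> w - g w) \<le> convex_conjugate g z"
  unfolding convex_conjugate_def by (rule SUP_upper2[of w]) (auto simp: inner_commute)

text \<open>Bounding a supremum means bounding each of its terms, and the bound on each term
  rearranges to the subgradient inequality.\<close>

lemma fenchel_young_eq_iff: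
  "convex_conjugate g z \<le> ereal (z \<bullet> w - g w) \<longleftrightarrow> z \<in> subdifferential g w"
  unfolding convex_conjugate_def subdifferential_def
  by (auto simp: SUP_le_iff inner_diff_right inner_commute[of z] algebra_simps)

lemma prox_conjugate_minus_half_norm_sq:
  fixes g :: "'a::real_inner \<Rightarrow> real"
  assumes diff: "g differentiable (at w)" and p: "p \<in> subdifferential g w"
    and \<gamma>: "0 < \<gamma>" "\<gamma> \<le> 1" and crit: "\<gamma> *\<^sub>R w + (1 - \<gamma>) *\<^sub>R p = x"
  shows "prox \<gamma> (\<lambda>z. convex_conjugate g z - ereal (1 / 2 * (norm z)\<^sup>2)) x = {p}"
proof -
  \<comment> \<open>Collecting the finite terms in \<open>r\<close> separates them from the
    conjugate, which may be infinite.\<close>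
  define r where "r z = 1 / (2 * \<gamma>) * (norm (z - x))\<^sup>2 - 1 / 2 * (norm z)\<^sup>2" for z
  let ?P = "\<lambda>z. convex_conjugate g z - ereal (1 / 2 * (norm z)\<^sup>2)
      + ereal (1 / (2 * \<gamma>) * (norm (z - x))\<^sup>2)"
  define q where "q z = z \<bullet> w - g w + r z" for z
  have P: "?P z = convex_conjugate g z + ereal (r z)" for z
    by (cases "convex_conjugate g z") (auto simp: r_def)
  \<comment> \<open>The linear part vanishes because \<open>crit\<close> gives
    \<open>(p - x) / \<gamma> = p - w\<close>, so the gradient of \<open>q\<close> at
    \<open>p\<close> is \<open>w + (p - w) - p = 0\<close>.\<close>
  have square: "q z = q p + (1 / \<gamma> - 1) / 2 * (norm (z - p))\<^sup>2" for z
    using \<gamma>(1) unfolding q_def r_def power2_norm_eq_inner crit[symmetric]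
    by (simp add: inner_add_left inner_add_right inner_diff_left inner_diff_right inner_commute
        field_simps)
  have q_min: "q p \<le> q z" for z
    using \<gamma> by (simp add: square[of z])
  have "convex_conjugate g p = ereal (p \<bullet> w - g w)"
    using p fenchel_young by (intro antisym) (auto simp: fenchel_young_eq_iff)
  then have P_p: "?P p = ereal (q p)"
    unfolding P by (simp add: q_def)
  have P_ge: "ereal (q z) \<le> ?P z" for z
    unfolding P using add_right_mono[OF fenchel_young[of z w g], of "ereal (r z)"]
    by (simp add: q_def)
  have "z = p" if "\<forall>y. ?P z \<le> ?P y" for z
  proof -
    \<comment> \<open>Minimality gives \<open>?P z \<le> ?P p = q p \<le> q z\<close>; the finite
      \<open>r z\<close> then cancels.\<close>
    have "convex_conjugate g z + ereal (r z) \<le> ereal (q z)"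
      using that P_p q_min[of z] unfolding P by (metis ereal_less_eq(3) order_trans)
    then have "convex_conjugate g z \<le> ereal (z \<bullet> w - g w)"
      by (cases "convex_conjugate g z") (auto simp: q_def)
    then show "z = p"
      using subgradient_unique[OF diff _ p] by (simp add: fenchel_young_eq_iff)
  qed
  moreover have "?P p \<le> ?P y" for y
    using P_p P_ge[of y] q_min[of y] by (metis ereal_less_eq(3) order_trans)
  ultimately show ?thesis
    unfolding prox_def by (auto simp: minimizers_iff)
qed

theorem mainTheorem5:
  fixes \<sigma> :: "real \<Rightarrow> real"
    and \<theta> :: "('n::finite) icnn_params"
    and \<alpha> \<gamma> :: real
    and f :: "real^'n \<Rightarrow> real^'n"
    and x :: "real^'n"
    and G :: "real^'n \<Rightarrow> real"
  assumes "is_LPN \<sigma> \<theta> \<alpha> f"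
    and "\<And>t. \<sigma> differentiable (at t)"
    and "0 < \<gamma>" and "\<gamma> \<le> 1"
    and "\<And>w. G w = \<gamma> / 2 * (norm w)\<^sup>2 + (1 - \<gamma>) * lpn_potential \<sigma> \<theta> \<alpha> w - x \<bullet> w"
  shows "strongly_convex (\<gamma> + (1 - \<gamma>) * \<alpha>) G \<and>
    (\<exists>w. minimizers G = {w} \<and> prox \<gamma> (lpn_regularizer \<sigma> \<theta> \<alpha>) x = {f w})"
proof -
  let ?\<mu> = "\<gamma> + (1 - \<gamma>) * \<alpha>"
  let ?\<Psi> = "lpn_potential \<sigma> \<theta> \<alpha>"
  have lpn: "0 < \<alpha>" "valid_icnn_params \<theta>" "icnn_activation \<sigma>"
    using assms(1) by (auto simp: is_LPN_def)
  \<comment> \<open>This is what remains of \<open>G\<close> once its own quadratic term and that of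
    the potential are merged into one with coefficient \<open>?\<mu> / 2\<close>.\<close>
  have "convex_on UNIV (\<lambda>w. (1 - \<gamma>) * icnn \<sigma> \<theta> w + (- x) \<bullet> w)"
    using assms(4) icnn_convex[OF lpn(2,3)]
    by (intro convex_on_add convex_on_cmul)
      (auto intro!: convex_onI simp: inner_add_right)
  moreover have "0 < ?\<mu>"
    using assms(3,4) lpn(1) by (simp add: add_pos_nonneg)
  ultimately have "strongly_convex ?\<mu>
      (\<lambda>w. (1 - \<gamma>) * icnn \<sigma> \<theta> w + (- x) \<bullet> w + ?\<mu> / 2 * (norm w)\<^sup>2)"
    by (rule strongly_convex_add_norm_sq)
  moreover have "(\<lambda>w. (1 - \<gamma>) * icnn \<sigma> \<theta> w + (- x) \<bullet> w + ?\<mu> / 2 * (norm w)\<^sup>2) = G"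
    by (auto simp: assms(5) lpn_potential_def field_simps)
  ultimately have sc: "strongly_convex ?\<mu> G"
    by simp
  have G_eq: "G = (\<lambda>w. \<gamma> * (1 / 2 * (norm w)\<^sup>2) + (1 - \<gamma>) * ?\<Psi> w + (- x) \<bullet> w)"
    by (auto simp: assms(5))
  have sub: "\<gamma> *\<^sub>R w + (1 - \<gamma>) *\<^sub>R f w + (- x) \<in> subdifferential G w" for w
    unfolding G_eq using assms(3,4)
    by (intro subdifferential_add subdifferential_scale subdifferential_half_norm_sq
        subdifferential_inner lpn_subgradient_potential assms(1)) auto
  have diff: "G differentiable (at w)" for w
    unfolding G_eq power2_norm_eq_inner
    by (intro differentiable_add differentiable_mult differentiable_inner differentiable_const
        differentiable_ident lpn_potential_differentiable assms(2))
  have "continuous_on UNIV G"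
    using diff by (intro differentiable_imp_continuous_on) (simp add: differentiable_on_def)
  from strongly_convex_unique_minimizer[OF sc this sub]
  obtain w where w: "minimizers G = {w}" ..
  \<comment> \<open>Zero and the explicit subgradient \<open>sub\<close> must agree at
    \<open>w\<close>, which yields the stationarity equation.\<close>
  then have "0 \<in> subdifferential G w"
    using minimizers_iff[of w G] by (simp add: subdifferential_def)
  from subgradient_unique[OF diff this sub]
  have "\<gamma> *\<^sub>R w + (1 - \<gamma>) *\<^sub>R f w = x"
    by (simp add: algebra_simps)
  then have "prox \<gamma> (lpn_regularizer \<sigma> \<theta> \<alpha>) x = {f w}"
    unfolding lpn_regularizer_def[abs_def]
    using lpn_potential_differentiable[OF assms(2)] lpn_subgradient_potential[OF assms(1)] assms(3,4)
    by (intro prox_conjugate_minus_half_norm_sq)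
  with sc w show ?thesis
    by blast
qed

end
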